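(* Let $x_1, x_2$ be indeterminates over $\mathbb{C}$. The four quaternion algebras \[ (x_1,x_2),\qquad (x_1,x_2+1),\qquad (x_2,x_1+1),\qquad (x_2,x_1x_2+1) \] over the field $\mathbb{C}(x_1,x_2)$ do not share a common maximal subfield; that is, there is no quadratic field extension $L$ of $\mathbb{C}(x_1,x_2)$ that embeds as a subfield into each of these four algebras.
   Context: For a field $F$ of characteristic not $2$ and $a,b\in F^\times$, $(a,b)$ denotes the quaternion algebra over $F$ generated by $i,j$ subject to $i^2=a$, $j^2=b$, $ij=-ji$. A maximal subfield of a quaternion division algebra is a subfield that is a quadratic extension of the center. *)

theory Defs
  imports "HOL-Computational_Algebra.Polynomial" "HOL-Computational_Algebra.Fraction_Field"
begin

type_synonym ratfun2 = "complex poly poly fract"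

definition X1 :: ratfun2 where "X1 = Fract [:[:0, 1:]:] 1"
definition X2 :: ratfun2 where "X2 = Fract [:0, 1:] 1"

text \<open>Elements (c0,c1,c2,c3) of the quaternion algebra (a,b) stand for
  c0 + c1 i + c2 j + c3 ij, with i^2 = a, j^2 = b, ij = -ji.\<close>
type_synonym 'f quat = "'f \<times> 'f \<times> 'f \<times> 'f"

definition qadd :: "'f::field quat \<Rightarrow> 'f quat \<Rightarrow> 'f quat" where
  "qadd x y = (case x of (x0,x1,x2,x3) \<Rightarrow> case y of (y0,y1,y2,y3) \<Rightarrow>
     (x0+y0, x1+y1, x2+y2, x3+y3))"

definition qmul :: "'f::field \<Rightarrow> 'f \<Rightarrow> 'f quat \<Rightarrow> 'f quat \<Rightarrow> 'f quat" where
  "qmul a b x y = (case x of (x0,x1,x2,x3) \<Rightarrow> case y of (y0,y1,y2,y3) \<Rightarrow>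
     (x0*y0 + a*x1*y1 + b*x2*y2 - a*b*x3*y3,
      x0*y1 + x1*y0 - b*x2*y3 + b*x3*y2,
      x0*y2 + x2*y0 + a*x1*y3 - a*x3*y1,
      x0*y3 + x3*y0 + x1*y2 - x2*y1))"

definition quadratic_extension :: "('f::field \<Rightarrow> 'l::field) \<Rightarrow> bool" where
  "quadratic_extension \<iota> \<longleftrightarrow>
     \<iota> 1 = 1 \<and> (\<forall>x y. \<iota> (x + y) = \<iota> x + \<iota> y) \<and> (\<forall>x y. \<iota> (x * y) = \<iota> x * \<iota> y) \<and>
     (\<exists>e1 e2. \<forall>z. \<exists>!c. z = \<iota> (fst c) * e1 + \<iota> (snd c) * e2)"

definition quat_embedding ::
  "'f::field \<Rightarrow> 'f \<Rightarrow> ('f \<Rightarrow> 'l::field) \<Rightarrow> ('l \<Rightarrow> 'f quat) \<Rightarrow> bool" where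
  "quat_embedding a b \<iota> \<phi> \<longleftrightarrow>
     inj \<phi> \<and> \<phi> 1 = (1, 0, 0, 0) \<and>
     (\<forall>x y. \<phi> (x + y) = qadd (\<phi> x) (\<phi> y)) \<and>
     (\<forall>x y. \<phi> (x * y) = qmul a b (\<phi> x) (\<phi> y)) \<and>
     (\<forall>c. \<phi> (\<iota> c) = (c, 0, 0, 0))"

end

theory Submission
  imports Defs
begin

text \<open>A generator with square c of a common maximal subfield is a pure quaternion in each algebra
  (a,b), so c = a u^2 + b v^2 - a b w^2 has a solution for each of the four pairs (a,b). Clear
  denominators, extend the 2-adic valuation to the complex numbers, and scale all coefficients so
  that they are integral and one of them is a unit. In residue characteristic 2 the forms become
  quasilinear over k(x^2,y^2) and their value sets, in terms of the basis 1, x, y, xy, are four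
  3-dimensional subspaces with zero intersection: writing c = A + B x + C y + D xy, they are A = 0,
  A = C, A = B and A = D. As each form is anisotropic over that field, every coefficient vanishes
  in the residue field, a contradiction.\<close>

section \<open>Valuation rings with residue characteristic two\<close>

definition is_subring :: "'a::comm_ring_1 set \<Rightarrow> bool" where
  "is_subring A \<longleftrightarrow> 1 \<in> A \<and> (\<forall>x\<in>A. \<forall>y\<in>A. x - y \<in> A \<and> x * y \<in> A)"

definition polys_over :: "'a::comm_ring_1 set \<Rightarrow> 'a poly set" where
  "polys_over A = {p. \<forall>i. coeff p i \<in> A}"

lemma
  assumes "is_subring A"
  shows subring_one: "1 \<in> A"
    and subring_diff: "\<And>x y. x \<in> A \<Longrightarrow> y \<in> A \<Longrightarrow> x - y \<in> A"
    and subring_mult: "\<And>x y. x \<in> A \<Longrightarrow> y \<in> A \<Longrightarrow> x * y \<in> A"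
    and subring_zero: "0 \<in> A"
    and subring_uminus: "\<And>x. x \<in> A \<Longrightarrow> - x \<in> A"
    and subring_add: "\<And>x y. x \<in> A \<Longrightarrow> y \<in> A \<Longrightarrow> x + y \<in> A"
    and subring_two: "2 \<in> A"
proof -
  show 1: "1 \<in> A" and d: "\<And>x y. x \<in> A \<Longrightarrow> y \<in> A \<Longrightarrow> x - y \<in> A"
    and "\<And>x y. x \<in> A \<Longrightarrow> y \<in> A \<Longrightarrow> x * y \<in> A"
    using assms by (auto simp: is_subring_def)
  show 0: "0 \<in> A" using d[OF 1 1] by simp
  show u: "- x \<in> A" if "x \<in> A" for x using d[OF 0 that] by simp
  show a: "x + y \<in> A" if "x \<in> A" "y \<in> A" for x y using d[OF that(1) u[OF that(2)]] by simp
  show "2 \<in> A" using a[OF 1 1] by simp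
qed

lemma subring_sum:
  assumes "is_subring A" "\<And>i. i \<in> I \<Longrightarrow> f i \<in> A"
  shows "sum f I \<in> A"
  using assms(2)
  by (induction I rule: infinite_finite_induct)
     (auto intro: subring_zero[OF assms(1)] subring_add[OF assms(1)])

lemma subring_power: "is_subring A \<Longrightarrow> x \<in> A \<Longrightarrow> x ^ n \<in> A"
  by (induction n) (auto intro: subring_one subring_mult)

lemma subring_poly:
  assumes "is_subring A" "p \<in> polys_over A" "x \<in> A"
  shows "poly p x \<in> A"
  unfolding poly_altdef using assms
  by (auto intro!: subring_sum subring_mult subring_power simp: polys_over_def)

lemma is_subring_polys_over:
  assumes "is_subring A"
  shows "is_subring (polys_over A)"
  using assms unfolding is_subring_def[of "polys_over A"]
  by (auto simp: polys_over_def coeff_mult one_pCons coeff_pCons split: nat.split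
      intro!: subring_sum subring_mult subring_one subring_zero subring_diff)

lemma const_in_polys_over: "is_subring A \<Longrightarrow> c \<in> A \<Longrightarrow> [:c:] \<in> polys_over A"
  by (auto simp: polys_over_def coeff_pCons subring_zero split: nat.split)

lemma monom_in_polys_over: "is_subring A \<Longrightarrow> c \<in> A \<Longrightarrow> monom c n \<in> polys_over A"
  by (auto simp: polys_over_def subring_zero)

lemma smult_in_polys_over:
  "is_subring A \<Longrightarrow> c \<in> A \<Longrightarrow> p \<in> polys_over A \<Longrightarrow> smult c p \<in> polys_over A"
  by (auto simp: polys_over_def subring_mult)

lemma reflect_poly_in_polys_over:
  "is_subring A \<Longrightarrow> p \<in> polys_over A \<Longrightarrow> reflect_poly p \<in> polys_over A"
  by (auto simp: polys_over_def coeff_reflect_poly subring_zero)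

text \<open>The image is the ring generated by \<open>A\<close> and \<open>x\<close>; evaluation at
  \<open>x\<close> carries the subring structure over from \<open>polys_over A\<close>.\<close>

lemma is_subring_adjoin:
  assumes "is_subring A"
  shows "is_subring ((\<lambda>p. poly p x) ` polys_over A)"
proof -
  note P = is_subring_polys_over[OF assms]
  show ?thesis
    unfolding is_subring_def
    using subring_one[OF P] subring_diff[OF P] subring_mult[OF P]
    by (auto simp flip: poly_diff poly_mult intro!: image_eqI[of 1 _ 1])
qed

section \<open>Subrings maximal without one half are valuation rings\<close>

lemma half_in_adjoin:
  fixes S :: "'a::field set"
  assumes S: "is_subring S" and half: "inverse 2 \<notin> S"
    and max: "\<And>T. is_subring T \<Longrightarrow> S \<subseteq> T \<Longrightarrow> inverse 2 \<notin> T \<Longrightarrow> T = S"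
    and x: "x \<notin> S"
  obtains p where "p \<in> polys_over S" "2 * poly p x = 1"
proof -
  let ?T = "(\<lambda>p. poly p x) ` polys_over S"
  have "S \<subseteq> ?T"
  proof
    fix c assume "c \<in> S"
    then show "c \<in> ?T"
      by (intro image_eqI[of _ _ "[:c:]"] const_in_polys_over S) auto
  qed
  moreover have "x \<in> ?T"
    by (intro image_eqI[of _ _ "monom 1 1"] monom_in_polys_over S subring_one)
       (auto simp: poly_monom)
  \<comment> \<open>\<open>?T\<close> is strictly larger than \<open>S\<close>, so maximality forces
    \<open>inverse 2\<close> into it.\<close>
  ultimately have "inverse 2 \<in> ?T"
    using max[OF is_subring_adjoin[OF S]] x by blast
  then obtain p where p: "p \<in> polys_over S" "poly p x = inverse 2" by auto
  \<comment> \<open>Since \<open>inverse 0 = 0\<close> lies in every subring, \<open>half\<close>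
    excludes characteristic 2.\<close>
  have "(2::'a) \<noteq> 0" using half subring_zero[OF S] by auto
  then have "2 * poly p x = 1" unfolding p(2) by (rule right_inverse)
  with p(1) show ?thesis using that by blast
qed

lemma power_one_minus_double:
  assumes A: "is_subring A" and "s \<in> A"
  shows "\<exists>t\<in>A. (1 - 2 * s) ^ n = 1 - 2 * t"
proof (induction n)
  case 0
  then show ?case by (intro bexI[of _ 0]) (auto simp: subring_zero[OF A])
next
  case (Suc n)
  then obtain t where t: "t \<in> A" "(1 - 2 * s) ^ n = 1 - 2 * t" by blast
  have "(1 - 2 * s) ^ Suc n = 1 - 2 * (t + s - 2 * (s * t))"
    unfolding power_Suc t(2) by (simp add: algebra_simps)
  moreover have "t + s - 2 * (s * t) \<in> A"
    by (intro subring_add[OF A] subring_diff[OF A] subring_mult[OF A] subring_two[OF A] t(1) assms(2))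
  ultimately show ?case by blast
qed

text \<open>Put \<open>y = 1 - 2 * s\<close>. Were \<open>inverse y\<close> outside
  \<open>S\<close>, one half would be a polynomial in \<open>inverse y\<close>; multiplying by
  \<open>y ^ degree p\<close>, which is again of the form \<open>1 - 2 * t\<close>, would put
  \<open>inverse 2\<close> into \<open>S\<close>.\<close>

lemma unit_if_maximal_without_half:
  fixes S :: "'a::field set"
  assumes S: "is_subring S" and half: "inverse 2 \<notin> S"
    and max: "\<And>T. is_subring T \<Longrightarrow> S \<subseteq> T \<Longrightarrow> inverse 2 \<notin> T \<Longrightarrow> T = S"
    and s: "s \<in> S"
  shows "inverse (1 - 2 * s) \<in> S"
proof (rule ccontr)
  assume "inverse (1 - 2 * s) \<notin> S"
  then obtain p where p: "p \<in> polys_over S" "2 * poly p (inverse (1 - 2 * s)) = 1"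
    using half_in_adjoin[OF S half max] by metis
  have nz: "1 - 2 * s \<noteq> 0"
  proof
    assume "1 - 2 * s = 0"
    then have "2 * s = 1" by simp
    then have "inverse 2 = s" by (rule inverse_unique)
    then show False using half s by metis
  qed
  obtain t where t: "t \<in> S" "(1 - 2 * s) ^ degree p = 1 - 2 * t"
    using power_one_minus_double[OF S s] by blast
  have "poly (reflect_poly p) (1 - 2 * s) \<in> S"
    by (intro subring_poly S reflect_poly_in_polys_over p subring_diff subring_one
        subring_mult subring_two s)
  moreover have "2 * poly (reflect_poly p) (1 - 2 * s) = (1 - 2 * t) * (2 * poly p (inverse (1 - 2 * s)))"
    using poly_reflect_poly_nz[OF nz] t by simp
  then have "inverse 2 = poly (reflect_poly p) (1 - 2 * s) + t"
    unfolding p(2) by (intro inverse_unique) (simp add: algebra_simps)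
  ultimately show False using half t subring_add[OF S] by metis
qed

text \<open>The reduction step of Chevalley's extension argument: multiplying the relation for
  \<open>inverse x\<close> by \<open>x ^ degree q\<close> gives a polynomial \<open>Q\<close> with
  root \<open>x\<close> whose coefficient at \<open>degree q\<close> is the unit
  \<open>1 - 2 * coeff q 0\<close>, so a multiple of \<open>Q\<close> cancels the leading term of
  \<open>p\<close>.\<close>

lemma lower_degree_half:
  fixes S :: "'a::field set"
  assumes S: "is_subring S" and half: "inverse 2 \<notin> S"
    and unit: "\<And>s. s \<in> S \<Longrightarrow> inverse (1 - 2 * s) \<in> S"
    and x: "x \<noteq> 0"
    and p: "p \<in> polys_over S" "2 * poly p x = 1"
    and q: "q \<in> polys_over S" "2 * poly q (inverse x) = 1"
    and deg: "degree q \<le> degree p"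
  shows "\<exists>p' \<in> polys_over S. 2 * poly p' x = 1 \<and> degree p' < degree p"
proof -
  define n m where "n = degree p" and "m = degree q"
  define Q where "Q = monom 1 m - smult 2 (reflect_poly q)"
  define u where "u = inverse (1 - 2 * coeff q 0)"
  define p' where "p' = p - smult (u * coeff p n) (monom 1 (n - m) * Q)"
  have q0: "coeff q 0 \<in> S" and pn: "coeff p n \<in> S" using p q by (auto simp: polys_over_def)
  have nz: "1 - 2 * coeff q 0 \<noteq> 0"
  proof
    assume "1 - 2 * coeff q 0 = 0"
    then have "2 * coeff q 0 = 1" by simp
    then have "inverse 2 = coeff q 0" by (rule inverse_unique)
    then show False using half q0 by metis
  qed
  have Q: "Q \<in> polys_over S"
    unfolding Q_def
    by (intro subring_diff[OF is_subring_polys_over[OF S]] monom_in_polys_over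
        smult_in_polys_over reflect_poly_in_polys_over subring_one subring_two S q)
  have "p' \<in> polys_over S"
    unfolding p'_def u_def
    by (intro subring_diff[OF is_subring_polys_over[OF S]] monom_in_polys_over
        smult_in_polys_over subring_mult[OF is_subring_polys_over[OF S]] subring_mult[OF S]
        subring_one unit S q0 pn p Q)
  moreover have "2 * poly (reflect_poly q) x = x ^ m"
    using poly_reflect_poly_nz[OF x, of q] q(2) m_def by (simp add: mult.left_commute)
  then have "poly Q x = 0" by (simp add: Q_def poly_monom)
  then have "2 * poly p' x = 1" using p(2) by (simp add: p'_def)
  moreover have "degree p' < n"
  proof -
    have "degree Q \<le> m"
      unfolding Q_def m_def
      by (intro degree_diff_le degree_monom_le order.trans[OF degree_smult_le] degree_reflect_poly_le)
    then have "degree (monom 1 (n - m) * Q) \<le> n"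
      using degree_mult_le[of "monom 1 (n - m)" Q] degree_monom_le[of "1::'a" "n - m"] deg
      by (auto simp: n_def m_def)
    then have "degree p' \<le> n"
      unfolding p'_def n_def
      by (intro degree_diff_le order.trans[OF degree_smult_le]) auto
    moreover have "coeff Q m = 1 - 2 * coeff q 0"
      by (simp add: Q_def m_def coeff_reflect_poly)
    then have "coeff p' n = 0"
      using deg nz by (simp add: p'_def coeff_monom_mult u_def n_def m_def)
    \<comment> \<open>A vanishing coefficient at \<open>n\<close> lowers the degree only for
      positive \<open>n\<close>; a constant \<open>p\<close> would be \<open>inverse 2\<close>
      itself.\<close>
    moreover have "n \<noteq> 0"
    proof
      assume "n = 0"
      then obtain a where a: "p = [:a:]" unfolding n_def by (metis degree_eq_zeroE)
      then have "a \<in> S" using pn \<open>n = 0\<close> by simp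
      moreover have "inverse 2 = a" using p(2) a by (intro inverse_unique) simp
      ultimately show False using half by metis
    qed
    ultimately show ?thesis
      by (metis degree_0 le_neq_implies_less leading_coeff_0_iff neq0_conv)
  qed
  ultimately show ?thesis unfolding n_def by blast
qed

text \<open>If both failed, take relations of minimal degree for \<open>x\<close> and for
  \<open>inverse x\<close>; the one of larger degree could be shortened by the other.\<close>

lemma valuation_if_maximal_without_half:
  fixes S :: "'a::field set"
  assumes S: "is_subring S" and half: "inverse 2 \<notin> S"
    and max: "\<And>T. is_subring T \<Longrightarrow> S \<subseteq> T \<Longrightarrow> inverse 2 \<notin> T \<Longrightarrow> T = S"
  shows "x \<in> S \<or> inverse x \<in> S"
proof (rule ccontr)
  assume *: "\<not> (x \<in> S \<or> inverse x \<in> S)"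
  then have x: "x \<noteq> 0" using subring_zero[OF S] by auto
  define H where "H y p \<longleftrightarrow> p \<in> polys_over S \<and> 2 * poly p y = 1" for y p
  have "\<exists>p. H y p \<and> (\<forall>q. H y q \<longrightarrow> degree p \<le> degree q)" if y: "y \<notin> S" for y
  proof -
    obtain p where "H y p" using half_in_adjoin[OF S half max y] H_def by metis
    then show ?thesis using ex_has_least_nat[of "H y" p degree] by blast
  qed
  then obtain p q where p: "H x p" "\<And>p'. H x p' \<Longrightarrow> degree p \<le> degree p'"
    and q: "H (inverse x) q" "\<And>q'. H (inverse x) q' \<Longrightarrow> degree q \<le> degree q'"
    using * by meson
  have "inverse (1 - 2 * s) \<in> S" if "s \<in> S" for s
    using unit_if_maximal_without_half[OF S half _ that] max by blast
  note low = lower_degree_half[OF S half this]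
  consider "degree q \<le> degree p" | "degree p \<le> degree q" by linarith
  then show False
  proof cases
    case 1
    then show ?thesis using low[OF _ x, of p q] p q unfolding H_def
      by (metis leD)
  next
    case 2
    then show ?thesis using low[of "inverse x" q p] x p q unfolding H_def
      by (metis leD inverse_inverse_eq inverse_zero_imp_zero)
  qed
qed

text \<open>Zorn's lemma for the subrings without \<open>inverse 2\<close>, a family that contains
  the integers. On the complex numbers the ring obtained belongs to a valuation extending the 2-adic
  one.\<close>

lemma exists_valuation_ring_over_two:
  "\<exists>S::'a::field_char_0 set. is_subring S \<and> inverse 2 \<notin> S \<and> (\<forall>x. x \<in> S \<or> inverse x \<in> S)"
proof -
  define \<A> where "\<A> = {S::'a set. is_subring S \<and> inverse 2 \<notin> S}"
  have "(inverse 2 :: 'a) \<notin> \<int>"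
  proof
    assume "(inverse 2 :: 'a) \<in> \<int>"
    then obtain k :: int where "(inverse 2 :: 'a) = of_int k" by (auto elim: Ints_cases)
    then have "(1::'a) = of_int (2 * k)" by (auto simp: field_simps)
    then have "1 = 2 * k" by (metis of_int_1 of_int_eq_iff)
    then show False by presburger
  qed
  then have "\<int> \<in> \<A>" by (auto simp: \<A>_def is_subring_def)
  moreover have "\<Union>\<C> \<in> \<A>" if "\<C> \<noteq> {}" and \<C>: "subset.chain \<A> \<C>" for \<C>
  proof -
    have sub: "\<And>S. S \<in> \<C> \<Longrightarrow> is_subring S \<and> inverse 2 \<notin> S"
      using \<C> by (auto simp: subset.chain_def \<A>_def)
    have "\<exists>S\<in>\<C>. x \<in> S \<and> y \<in> S" if "x \<in> \<Union>\<C>" "y \<in> \<Union>\<C>" for x y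
      using that subset.chain_total[OF \<C>] by blast
    then have "\<forall>x\<in>\<Union>\<C>. \<forall>y\<in>\<Union>\<C>. x - y \<in> \<Union>\<C> \<and> x * y \<in> \<Union>\<C>"
      using sub by (meson UnionI subring_diff subring_mult)
    moreover have "1 \<in> \<Union>\<C>" using sub \<open>\<C> \<noteq> {}\<close> subring_one by blast
    ultimately show ?thesis using sub by (auto simp: \<A>_def is_subring_def)
  qed
  ultimately obtain S where S: "S \<in> \<A>" "\<And>T. T \<in> \<A> \<Longrightarrow> S \<subseteq> T \<Longrightarrow> T = S"
    using subset_Zorn_nonempty[of \<A>] by (metis empty_iff)
  then show ?thesis
    using valuation_if_maximal_without_half[of S] by (auto simp: \<A>_def)
qed

section \<open>The maximal ideal and congruences modulo it\<close>

locale dyadic_valuation_ring =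
  fixes S :: "'a::field set"
  assumes subring: "is_subring S"
    and half: "inverse 2 \<notin> S"
    and total: "x \<in> S \<or> inverse x \<in> S"
begin

text \<open>The maximal ideal, as the set of nonunits; 0 is listed separately because
  \<open>inverse 0 = 0\<close> lies in \<open>S\<close>.\<close>

definition M :: "'a set" where "M = {x \<in> S. x = 0 \<or> inverse x \<notin> S}"

text \<open>Defined on the whole field, so that adding and subtracting congruences needs no
  membership in \<open>S\<close>.\<close>

definition cong_M :: "'a \<Rightarrow> 'a \<Rightarrow> bool" (infix "\<approx>" 50) where "x \<approx> y \<longleftrightarrow> x - y \<in> M"

lemma zero_in_M: "0 \<in> M"
  by (simp add: M_def subring_zero[OF subring])

lemma one_notin_M: "1 \<notin> M"
  by (simp add: M_def subring_one[OF subring])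

lemma two_in_M: "2 \<in> M"
  using half by (simp add: M_def subring_two[OF subring] del: inverse_eq_divide_numeral)

lemma mult_in_M: "s \<in> S \<Longrightarrow> x \<in> M \<Longrightarrow> s * x \<in> M"
proof -
  assume s: "s \<in> S" and x: "x \<in> M"
  then have "s * x \<in> S" by (auto simp: M_def intro: subring_mult[OF subring])
  moreover have "inverse x \<in> S" if "inverse (s * x) \<in> S" "s * x \<noteq> 0"
    using subring_mult[OF subring s that(1)] that(2) by (simp add: field_simps)
  ultimately show ?thesis using x by (auto simp: M_def)
qed

lemma square_in_M: "x \<in> S \<Longrightarrow> x * x \<in> M \<Longrightarrow> x \<in> M"
  by (auto simp: M_def intro: subring_mult[OF subring])

text \<open>For nonzero summands one of the two quotients lies in \<open>S\<close>, and
  \<open>a + b = (1 + inverse a * b) * a\<close> is then an \<open>S\<close>-multiple of an element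
  of \<open>M\<close>.\<close>

lemma add_in_M:
  assumes "x \<in> M" "y \<in> M"
  shows "x + y \<in> M"
proof -
  have *: "a + b \<in> M" if a: "a \<in> M" and b: "b \<in> M" and "inverse a * b \<in> S" "a \<noteq> 0" for a b
    using mult_in_M[OF subring_add[OF subring subring_one[OF subring] that(3)] a] that(4)
    by (simp add: distrib_right mult.commute[of "inverse a"] mult.assoc)
  consider "x = 0" | "y = 0" | "x \<noteq> 0" "y \<noteq> 0" by blast
  then show ?thesis
  proof cases
    case 3
    have "inverse x * y \<in> S \<or> inverse y * x \<in> S"
      using total[of "inverse x * y"] by (simp add: mult.commute)
    then show ?thesis using *[OF assms] *[OF assms(2,1)] 3 by (auto simp: add.commute)
  qed (use assms in auto)
qed

lemma uminus_in_M: "x \<in> M \<Longrightarrow> - x \<in> M"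
  using mult_in_M[OF subring_uminus[OF subring subring_one[OF subring]]] by simp

lemma cong_M_zero: "x \<approx> 0 \<longleftrightarrow> x \<in> M"
  by (simp add: cong_M_def)

lemma cong_M_refl: "x \<approx> x"
  by (simp add: cong_M_def zero_in_M)

lemma cong_M_sym: "x \<approx> y \<Longrightarrow> y \<approx> x"
  using uminus_in_M[of "x - y"] by (simp add: cong_M_def)

lemma cong_M_trans: "x \<approx> y \<Longrightarrow> y \<approx> z \<Longrightarrow> x \<approx> z"
  using add_in_M[of "x - y" "y - z"] by (simp add: cong_M_def)

lemma cong_M_add: "x \<approx> y \<Longrightarrow> x' \<approx> y' \<Longrightarrow> x + x' \<approx> y + y'"
  using add_in_M[of "x - y" "x' - y'"] by (simp add: cong_M_def algebra_simps)

lemma cong_M_diff: "x \<approx> y \<Longrightarrow> x' \<approx> y' \<Longrightarrow> x - x' \<approx> y - y'"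
  using add_in_M[OF _ uminus_in_M, of "x - y" "x' - y'"] by (simp add: cong_M_def algebra_simps)

text \<open>An element of least valuation. Dividing by it later makes all coefficients integral and
  one of them 1.\<close>

lemma exists_dividing_element:
  assumes "finite A" "A \<noteq> {}" "0 \<notin> A"
  shows "\<exists>d\<in>A. \<forall>a\<in>A. a * inverse d \<in> S"
  using assms
proof (induction A rule: finite_ne_induct)
  case (singleton x)
  then show ?case using subring_one[OF subring] by simp
next
  case (insert x A)
  then obtain d where d: "d \<in> A" "\<forall>a\<in>A. a * inverse d \<in> S" by auto
  have nz: "d \<noteq> 0" "x \<noteq> 0" using d insert by auto
  show ?case
  proof (cases "x * inverse d \<in> S")
    case True
    then show ?thesis using d by auto
  next
    case False
    then have dx: "d * inverse x \<in> S"
      using total[of "x * inverse d"] by (simp add: mult.commute)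
    have "a * inverse x \<in> S" if "a \<in> A" for a
      using subring_mult[OF subring d(2)[rule_format, OF that] dx] nz by (simp add: field_simps)
    then show ?thesis using nz subring_one[OF subring] by (intro bexI[of _ x]) auto
  qed
qed

end

section \<open>Squares modulo two\<close>

text \<open>The convolution terms at \<open>i\<close> and \<open>n - i\<close> agree and pair up,
  leaving a middle term for even \<open>n\<close>. The cross sum is explicit so that its membership
  in \<open>S\<close> can be checked.\<close>

lemma coeff_square:
  fixes p :: "'a::comm_ring_1 poly"
  shows "coeff (p * p) n = (if even n then coeff p (n div 2) * coeff p (n div 2) else 0)
           + 2 * (\<Sum>i<(n + 1) div 2. coeff p i * coeff p (n - i))"
proof -
  define f where "f i = coeff p i * coeff p (n - i)" for i
  \<comment> \<open>Lower, middle and upper block; for \<open>k = (n + 1) div 2\<close> the middle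
    block is a single index or empty.\<close>
  have split: "coeff (p * p) n = sum f {..<k} + sum f {k..n - k} + sum f {n - k<..n}"
    if "2 * k \<le> n + 1" for k
  proof -
    have "{..n} = {..<k} \<union> {k..n - k} \<union> {n - k<..n}" using that by auto
    then have "coeff (p * p) n = sum f ({..<k} \<union> {k..n - k} \<union> {n - k<..n})"
      by (simp add: coeff_mult f_def)
    also have "\<dots> = sum f ({..<k} \<union> {k..n - k}) + sum f {n - k<..n}"
      using that by (intro sum.union_disjoint) auto
    also have "sum f ({..<k} \<union> {k..n - k}) = sum f {..<k} + sum f {k..n - k}"
      by (intro sum.union_disjoint) auto
    finally show ?thesis .
  qed
  have upper: "sum f {n - k<..n} = sum f {..<k}" if "2 * k \<le> n + 1" for k
    by (rule sum.reindex_bij_witness[of _ "\<lambda>i. n - i" "\<lambda>i. n - i"])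
       (use that in \<open>auto simp: f_def mult.commute\<close>)
  show ?thesis
  proof (cases "even n")
    case True
    then obtain m where m: "n = 2 * m" by (elim evenE)
    have k: "(n + 1) div 2 = m" "n div 2 = m" and le: "2 * m \<le> n + 1" using m by auto
    have "{m..n - m} = {m}" using m by auto
    then have "coeff (p * p) n = f m + 2 * sum f {..<m}"
      using split[OF le] upper[OF le] by simp
    moreover have "f m = coeff p m * coeff p m" by (simp add: f_def m)
    ultimately show ?thesis unfolding k f_def using True by simp
  next
    case False
    then obtain m where m: "n = 2 * m + 1" by (elim oddE)
    have k: "(n + 1) div 2 = Suc m" and le: "2 * Suc m \<le> n + 1" using m by auto
    have "{Suc m..n - Suc m} = {}" using m by auto
    then have "coeff (p * p) n = 2 * sum f {..<Suc m}"
      using split[OF le] upper[OF le] by simp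
    then show ?thesis unfolding k f_def using False by simp
  qed
qed

section \<open>Bivariate coefficients and their parity classes\<close>

definition PX :: "'a::comm_ring_1 poly poly" where "PX = [:[:0, 1:]:]"
definition PY :: "'a::comm_ring_1 poly poly" where "PY = [:0, 1:]"

text \<open>\<open>PX\<close> is the inner variable and \<open>PY\<close> the outer one, so the
  coefficient of \<open>PX^i * PY^j\<close> is reached through \<open>j\<close> first.\<close>

definition coeff2 :: "'a::comm_ring_1 poly poly \<Rightarrow> nat \<Rightarrow> nat \<Rightarrow> 'a" where
  "coeff2 p i j = coeff (coeff p j) i"

text \<open>These rules strip one leading variable at a time, which is why monomials below are
  right-nested products.\<close>

lemma coeff2_simps [simp]:
  "coeff2 (p + q) i j = coeff2 p i j + coeff2 q i j"
  "coeff2 (p - q) i j = coeff2 p i j - coeff2 q i j"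
  "coeff2 (PX * p) 0 j = 0"
  "coeff2 (PX * p) (Suc i) j = coeff2 p i j"
  "coeff2 (PY * p) i 0 = 0"
  "coeff2 (PY * p) i (Suc j) = coeff2 p i j"
  by (simp_all add: coeff2_def PX_def PY_def)

context dyadic_valuation_ring
begin

abbreviation R2 :: "'a poly poly set" where "R2 \<equiv> polys_over (polys_over S)"

lemma coeff2_in_S: "p \<in> R2 \<Longrightarrow> coeff2 p i j \<in> S"
  by (simp add: polys_over_def coeff2_def)

text \<open>\<open>coeff_square\<close> is applied in the outer variable, then to the remaining
  square in the inner one; both cross sums carry a factor 2 and vanish modulo
  \<open>M\<close>.\<close>

lemma coeff2_square:
  assumes p: "p \<in> R2"
  shows "coeff2 (p * p) i j
    \<approx> (if even i \<and> even j then coeff2 p (i div 2) (j div 2) * coeff2 p (i div 2) (j div 2) else 0)"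
proof -
  note PS = is_subring_polys_over[OF subring]
  have double: "x + 2 * y \<approx> x" if "y \<in> S" for x y
    using mult_in_M[OF that two_in_M] by (simp add: cong_M_def mult.commute)
  have row: "coeff p k \<in> polys_over S" for k using p by (simp add: polys_over_def[of "polys_over S"])
  define q where "q = (\<Sum>i<(j + 1) div 2. coeff p i * coeff p (j - i))"
  have "q \<in> polys_over S" unfolding q_def
    by (intro subring_sum[OF PS] subring_mult[OF PS] row)
  then have "coeff q i \<in> S" by (simp add: polys_over_def)
  moreover have "coeff2 (p * p) i j
      = (if even j then coeff (coeff p (j div 2) * coeff p (j div 2)) i else 0) + 2 * coeff q i"
    unfolding coeff2_def coeff_square[of p j] q_def[symmetric] mult_2
    by (cases "even j") (simp_all only: if_True if_False coeff_add coeff_0)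
  ultimately have 1: "coeff2 (p * p) i j
     \<approx> (if even j then coeff (coeff p (j div 2) * coeff p (j div 2)) i else 0)"
    using double by simp
  define r where "r = coeff p (j div 2)"
  have "(\<Sum>k<(i + 1) div 2. coeff r k * coeff r (i - k)) \<in> S"
    using row[of "j div 2"] unfolding r_def
    by (auto intro!: subring_sum[OF subring] subring_mult[OF subring] simp: polys_over_def)
  from double[OF this] have 2: "coeff (r * r) i
     \<approx> (if even i then coeff r (i div 2) * coeff r (i div 2) else 0)"
    unfolding coeff_square[of r i] .
  show ?thesis
  proof (cases "even j")
    case True
    then have "coeff2 (p * p) i j \<approx> coeff (r * r) i" using 1 unfolding r_def by (simp only: if_True)
    from cong_M_trans[OF this 2] True show ?thesis
      unfolding r_def coeff2_def by (simp only: simp_thms)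
  next
    case False
    then show ?thesis using 1 by (simp only: if_False simp_thms)
  qed
qed

lemma coeff2_square_parity:
  assumes "p \<in> R2"
  shows "coeff2 (p * p) (2 * i) (2 * j) \<approx> coeff2 p i j * coeff2 p i j"
    and "coeff2 (p * p) (Suc (2 * i)) k \<approx> 0"
    and "coeff2 (p * p) k (Suc (2 * j)) \<approx> 0"
  using coeff2_square[OF assms, of "2 * i" "2 * j"]
    coeff2_square[OF assms, of "Suc (2 * i)" k] coeff2_square[OF assms, of k "Suc (2 * j)"]
  by simp_all

lemma coeff2_PX_square:
  assumes "p \<in> R2"
  shows "coeff2 (PX * (p * p)) (2 * i) j \<approx> 0"
  \<comment> \<open>For positive \<open>i\<close> the shift leads to the odd exponent
    \<open>Suc (2 * (i - 1))\<close>; for \<open>i = 0\<close> the coefficient is 0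
    outright.\<close>
  using coeff2_square_parity(2)[OF assms, of "i - 1" j] by (cases i) (auto simp: cong_M_refl)

lemma coeff2_PY_square:
  assumes "p \<in> R2"
  shows "coeff2 (PY * (p * p)) i (2 * j) \<approx> 0"
  using coeff2_square_parity(3)[OF assms, of i "j - 1"] by (cases j) (auto simp: cong_M_refl)

lemma coeff2_PX_PY_square:
  assumes "p \<in> R2"
  shows "coeff2 (PX * (PY * (p * p))) (2 * i) j \<approx> 0"
    and "coeff2 (PX * (PY * (p * p))) i (2 * j) \<approx> 0"
proof -
  show "coeff2 (PX * (PY * (p * p))) (2 * i) j \<approx> 0"
    using coeff2_square_parity(2)[OF assms, of "i - 1" "j - 1"]
    by (cases i; cases j) (auto simp: cong_M_refl)
  show "coeff2 (PX * (PY * (p * p))) i (2 * j) \<approx> 0"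
    using coeff2_square_parity(3)[OF assms, of "i - 1" "j - 1"]
    by (cases i; cases j) (auto simp: cong_M_refl)
qed

text \<open>This monomial comes from the fourth algebra: two factors \<open>PY\<close> restore even
  parity in \<open>PY\<close> while moving the exponent by 2.\<close>

lemma coeff2_PX_PY_PY_square:
  assumes "p \<in> R2"
  shows "coeff2 (PX * (PY * (PY * (p * p)))) (2 * i) j \<approx> 0"
    and "coeff2 (PX * (PY * (PY * (p * p)))) i (Suc (2 * j)) \<approx> 0"
proof -
  show "coeff2 (PX * (PY * (PY * (p * p)))) (2 * i) j \<approx> 0"
    using coeff2_square_parity(2)[OF assms, of "i - 1" "j - 2"]
    by (cases i; cases j; cases "j - 1") (auto simp: cong_M_refl)
  show "coeff2 (PX * (PY * (PY * (p * p)))) i (Suc (2 * j)) \<approx> 0"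
    using coeff2_square_parity(3)[OF assms, of "i - 1" "j - 1"]
    by (cases i; cases j) (auto simp: cong_M_refl)
qed

lemmas coeff2_cong =
  coeff2_square_parity coeff2_PX_square coeff2_PY_square coeff2_PX_PY_square
  coeff2_PX_PY_PY_square


text \<open>Modulo 2, squares are polynomials in the squares of the variables, so the coefficients at
  the four parity classes of exponents are read off separately; the even-even class is 0 for \<open>c1\<close>
  and is the square of \<open>v2\<close>, \<open>v3\<close>, \<open>v4\<close> for the others.\<close>

lemma common_value_vanishes_mod_M:
  fixes u1 v1 w1 u2 v2 w2 u3 v3 w3 u4 v4 w4 :: "'a poly poly"
  defines "c1 \<equiv> PX * (u1 * u1) + PY * (v1 * v1) - PX * (PY * (w1 * w1))"
    and "c2 \<equiv> PX * (u2 * u2) + (PY * (v2 * v2) + v2 * v2) - (PX * (PY * (w2 * w2)) + PX * (w2 * w2))"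
    and "c3 \<equiv> PY * (u3 * u3) + (PX * (v3 * v3) + v3 * v3) - (PX * (PY * (w3 * w3)) + PY * (w3 * w3))"
    and "c4 \<equiv> PY * (u4 * u4) + (PX * (PY * (v4 * v4)) + v4 * v4)
               - (PX * (PY * (PY * (w4 * w4))) + PY * (w4 * w4))"
  assumes R: "u1 \<in> R2" "v1 \<in> R2" "w1 \<in> R2" "u2 \<in> R2" "v2 \<in> R2" "w2 \<in> R2"
      "u3 \<in> R2" "v3 \<in> R2" "w3 \<in> R2" "u4 \<in> R2" "v4 \<in> R2" "w4 \<in> R2"
    and eq: "c1 = c2" "c1 = c3" "c1 = c4"
    and p: "p \<in> {u1, v1, w1, u2, v2, w2, u3, v3, w3, u4, v4, w4}"
  shows "coeff2 p i j \<in> M"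
proof -
  define sq where "sq p i j = coeff2 p i j * coeff2 p i j" for p :: "'a poly poly" and i j
  have M: "coeff2 p i j \<in> M" if "p \<in> R2" "sq p i j \<approx> 0" for p i j
    using square_in_M[OF coeff2_in_S[OF that(1)]] that(2) by (simp add: cong_M_zero sq_def)
  \<comment> \<open>Here and below the right-hand sides keep the shape of the defining sums, zeros
    included, so that the congruence rules apply term by term.\<close>
  have c1: "coeff2 c1 (2 * i) (2 * j) \<approx> 0 + 0 - 0"
    "coeff2 c1 (2 * i) (Suc (2 * j)) \<approx> 0 + sq v1 i j - 0"
    "coeff2 c1 (Suc (2 * i)) (2 * j) \<approx> sq u1 i j + 0 - 0"
    "coeff2 c1 (Suc (2 * i)) (Suc (2 * j)) \<approx> 0 + 0 - sq w1 i j" for i j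
    unfolding c1_def coeff2_simps sq_def by (intro cong_M_add cong_M_diff coeff2_cong R)+
  have c2: "coeff2 c2 (2 * i) (2 * j) \<approx> 0 + (0 + sq v2 i j) - (0 + 0)"
    "coeff2 c2 (2 * i) (Suc (2 * j)) \<approx> 0 + (sq v2 i j + 0) - (0 + 0)"
    "coeff2 c2 (Suc (2 * i)) (2 * j) \<approx> sq u2 i j + (0 + 0) - (0 + sq w2 i j)"
    "coeff2 c2 (Suc (2 * i)) (Suc (2 * j)) \<approx> 0 + (0 + 0) - (sq w2 i j + 0)" for i j
    unfolding c2_def coeff2_simps sq_def by (intro cong_M_add cong_M_diff coeff2_cong R)+
  have c3: "coeff2 c3 (2 * i) (2 * j) \<approx> 0 + (0 + sq v3 i j) - (0 + 0)"
    "coeff2 c3 (2 * i) (Suc (2 * j)) \<approx> sq u3 i j + (0 + 0) - (0 + sq w3 i j)"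
    "coeff2 c3 (Suc (2 * i)) (2 * j) \<approx> 0 + (sq v3 i j + 0) - (0 + 0)"
    "coeff2 c3 (Suc (2 * i)) (Suc (2 * j)) \<approx> 0 + (0 + 0) - (sq w3 i j + 0)" for i j
    unfolding c3_def coeff2_simps sq_def by (intro cong_M_add cong_M_diff coeff2_cong R)+
  \<comment> \<open>The term of \<open>c4\<close> with \<open>PX\<close> and two factors
    \<open>PY\<close> lives at even \<open>PY\<close>-exponents from 2 on, hence the index
    \<open>Suc (Suc (2 * j))\<close>.\<close>
  have c4: "coeff2 c4 (2 * i) (2 * j) \<approx> 0 + (0 + sq v4 i j) - (0 + 0)"
    "coeff2 c4 (2 * i) (Suc (2 * j)) \<approx> sq u4 i j + (0 + 0) - (0 + sq w4 i j)"
    "coeff2 c4 (Suc (2 * i)) (Suc (Suc (2 * j))) \<approx> 0 + (0 + 0) - (sq w4 i j + 0)"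
    "coeff2 c4 (Suc (2 * i)) (Suc (2 * j)) \<approx> 0 + (sq v4 i j + 0) - (0 + 0)" for i j
    unfolding c4_def coeff2_simps sq_def by (intro cong_M_add cong_M_diff coeff2_cong R)+
  note trans = cong_M_trans[OF cong_M_sym]
  have v: "sq v2 i j \<approx> 0" "sq v3 i j \<approx> 0" "sq v4 i j \<approx> 0" for i j
    using trans[OF c2(1) c1(1)[unfolded eq(1)]] trans[OF c3(1) c1(1)[unfolded eq(2)]]
      trans[OF c4(1) c1(1)[unfolded eq(3)]] by simp_all
  have neg: "x \<approx> 0" if "- x \<approx> 0" for x
    using that uminus_in_M[of "- x"] by (simp add: cong_M_zero)
  \<comment> \<open>Each remaining parity class of \<open>c1\<close> is compared with the form whose
    coefficient there is the square of \<open>v2\<close>, \<open>v3\<close> or \<open>v4\<close>,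
    already known to vanish.\<close>
  have 1: "sq v1 i j \<approx> 0" "sq u1 i j \<approx> 0" "- sq w1 i j \<approx> 0" for i j
  proof -
    have "sq v1 i j \<approx> sq v2 i j" "sq u1 i j \<approx> sq v3 i j" "- sq w1 i j \<approx> sq v4 i j"
      using trans[OF c1(2)[unfolded eq(1)] c2(2)] trans[OF c1(3)[unfolded eq(2)] c3(3)]
        trans[OF c1(4)[unfolded eq(3)] c4(4)] by simp_all
    then show "sq v1 i j \<approx> 0" "sq u1 i j \<approx> 0" "- sq w1 i j \<approx> 0"
      using v by (blast intro: cong_M_trans)+
  qed
  \<comment> \<open>The last item is the odd-even class with the \<open>PY\<close>-exponent raised
    by 2, for comparison with the \<open>w4\<close> term of \<open>c4\<close>.\<close>
  have c1_zero: "coeff2 c1 (2 * i) (2 * j) \<approx> 0" "coeff2 c1 (2 * i) (Suc (2 * j)) \<approx> 0"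
    "coeff2 c1 (Suc (2 * i)) (2 * j) \<approx> 0" "coeff2 c1 (Suc (2 * i)) (Suc (2 * j)) \<approx> 0"
    "coeff2 c1 (Suc (2 * i)) (Suc (Suc (2 * j))) \<approx> 0" for i j
    using c1(1)[of i j] cong_M_trans[OF _ 1(1), of _ i j] cong_M_trans[OF _ 1(2), of _ i j]
      cong_M_trans[OF _ 1(3), of _ i j] cong_M_trans[OF _ 1(2), of _ i "Suc j"]
      c1(2-4)[of i j] c1(3)[of i "Suc j"]
    by simp_all
  have w: "sq w2 i j \<approx> 0" "sq w3 i j \<approx> 0" "sq w4 i j \<approx> 0" for i j
    using trans[OF c2(4) c1_zero(4)[unfolded eq(1)]] trans[OF c3(4) c1_zero(4)[unfolded eq(2)]]
      trans[OF c4(3) c1_zero(5)[unfolded eq(3)]] neg by simp_all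
  \<comment> \<open>In the last three forms \<open>u\<close> shares its parity class with
    \<open>w\<close>, so it vanishes once \<open>w\<close> does.\<close>
  have u: "sq u2 i j \<approx> 0" "sq u3 i j \<approx> 0" "sq u4 i j \<approx> 0" for i j
  proof -
    have *: "x \<approx> 0" if "x - y \<approx> 0" "y \<approx> 0" for x y
      using cong_M_add[OF that] by simp
    have "sq u2 i j - sq w2 i j \<approx> 0" "sq u3 i j - sq w3 i j \<approx> 0" "sq u4 i j - sq w4 i j \<approx> 0"
      using trans[OF c2(3) c1_zero(3)[unfolded eq(1)]] trans[OF c3(2) c1_zero(2)[unfolded eq(2)]]
        trans[OF c4(2) c1_zero(2)[unfolded eq(3)]] by simp_all
    then show "sq u2 i j \<approx> 0" "sq u3 i j \<approx> 0" "sq u4 i j \<approx> 0"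
      using *[OF _ w(1)] *[OF _ w(2)] *[OF _ w(3)] by blast+
  qed
  show ?thesis using p R M u v w 1(1,2) 1(3)[THEN neg] by auto
qed

end

section \<open>Scaling to integral coefficients with one unit\<close>

lemma coeff2_eq_zero_iff: "p = 0 \<longleftrightarrow> (\<forall>i j. coeff2 p i j = 0)"
  by (auto simp: coeff2_def poly_eq_iff)

lemma coeff2_scale: "coeff2 ([:[:c:]:] * p) i j = c * coeff2 p i j"
  by (simp add: coeff2_def)

lemma finite_coeff2: "finite {coeff2 p i j |i j. coeff2 p i j \<noteq> 0}"
proof -
  have "finite (\<Union>q\<in>set (coeffs p). set (coeffs q))" by simp
  moreover have "{coeff2 p i j |i j. coeff2 p i j \<noteq> 0} \<subseteq> (\<Union>q\<in>set (coeffs p). set (coeffs q))"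
  proof
    fix c assume "c \<in> {coeff2 p i j |i j. coeff2 p i j \<noteq> 0}"
    then obtain i j where c: "c = coeff (coeff p j) i" "c \<noteq> 0" by (auto simp: coeff2_def)
    then have "coeff p j \<noteq> 0" by auto
    then have "coeff p j \<in> set (coeffs p)" "c \<in> set (coeffs (coeff p j))"
      using c by (auto intro!: coeff_in_coeffs le_degree)
    then show "c \<in> (\<Union>q\<in>set (coeffs p). set (coeffs q))" by blast
  qed
  ultimately show ?thesis using finite_subset by blast
qed

text \<open>After division by a coefficient of least valuation all coefficients lie in
  \<open>S\<close> and one equals 1, yet all of them would have to lie in \<open>M\<close>.\<close>

lemma no_common_value_polynomial:
  fixes u1 v1 w1 u2 v2 w2 u3 v3 w3 u4 v4 w4 :: "'a::field_char_0 poly poly"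
  assumes eq: "PX * u1^2 + PY * v1^2 - PX * PY * w1^2
       = PX * u2^2 + (PY + 1) * v2^2 - PX * (PY + 1) * w2^2"
     "PX * u1^2 + PY * v1^2 - PX * PY * w1^2
       = PY * u3^2 + (PX + 1) * v3^2 - PY * (PX + 1) * w3^2"
     "PX * u1^2 + PY * v1^2 - PX * PY * w1^2
       = PY * u4^2 + (PX * PY + 1) * v4^2 - PY * (PX * PY + 1) * w4^2"
  shows "\<forall>p \<in> {u1, v1, w1, u2, v2, w2, u3, v3, w3, u4, v4, w4}. p = 0"
proof (rule ccontr)
  obtain S :: "'a set" where "is_subring S" "inverse 2 \<notin> S" "\<forall>x. x \<in> S \<or> inverse x \<in> S"
    using exists_valuation_ring_over_two by blast
  then interpret dyadic_valuation_ring S by unfold_locales auto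
  define U where "U = {u1, v1, w1, u2, v2, w2, u3, v3, w3, u4, v4, w4}"
  assume "\<not> (\<forall>p \<in> {u1, v1, w1, u2, v2, w2, u3, v3, w3, u4, v4, w4}. p = 0)"
  then obtain p where p: "p \<in> U" "p \<noteq> 0" by (auto simp: U_def)
  define A where "A = (\<Union>p\<in>U. {coeff2 p i j |i j. coeff2 p i j \<noteq> 0})"
  have "finite A" unfolding A_def by (intro finite_UN_I finite_coeff2) (simp add: U_def)
  moreover have "A \<noteq> {}" using p unfolding A_def coeff2_eq_zero_iff[of p] by blast
  moreover have "0 \<notin> A" by (auto simp: A_def)
  ultimately obtain d where d: "d \<in> A" "\<And>a. a \<in> A \<Longrightarrow> a * inverse d \<in> S"
    using exists_dividing_element[of A] by meson
  have d0: "d \<noteq> 0" using d(1) \<open>0 \<notin> A\<close> by auto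
  define k where "k = ([:[:inverse d:]:] :: 'a poly poly)"
  have k: "coeff2 (k * q) i j = inverse d * coeff2 q i j" for q i j
    unfolding k_def by (rule coeff2_scale)
  have R: "k * q \<in> R2" if "q \<in> U" for q
  proof -
    have "coeff2 (k * q) i j \<in> S" for i j
    proof (cases "coeff2 q i j = 0")
      case True
      then show ?thesis by (simp add: k subring_zero[OF subring])
    next
      case False
      then have "coeff2 q i j \<in> A" using that by (auto simp: A_def)
      then show ?thesis using d(2) by (simp add: k mult.commute[of "inverse d"])
    qed
    then show ?thesis by (simp add: polys_over_def coeff2_def)
  qed
  \<comment> \<open>Homogeneity of degree 2 lets \<open>k^2\<close> pass into the squares; the
    right-hand sides have the nested shape required by
    \<open>common_value_vanishes_mod_M\<close>.\<close>
  have scale: "k^2 * (PX * u^2 + PY * v^2 - PX * PY * w^2)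
      = PX * (k * u * (k * u)) + PY * (k * v * (k * v)) - PX * (PY * (k * w * (k * w)))"
    "k^2 * (PX * u^2 + (PY + 1) * v^2 - PX * (PY + 1) * w^2)
      = PX * (k * u * (k * u)) + (PY * (k * v * (k * v)) + k * v * (k * v))
        - (PX * (PY * (k * w * (k * w))) + PX * (k * w * (k * w)))"
    "k^2 * (PY * u^2 + (PX + 1) * v^2 - PY * (PX + 1) * w^2)
      = PY * (k * u * (k * u)) + (PX * (k * v * (k * v)) + k * v * (k * v))
        - (PX * (PY * (k * w * (k * w))) + PY * (k * w * (k * w)))"
    "k^2 * (PY * u^2 + (PX * PY + 1) * v^2 - PY * (PX * PY + 1) * w^2)
      = PY * (k * u * (k * u)) + (PX * (PY * (k * v * (k * v))) + k * v * (k * v))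
        - (PX * (PY * (PY * (k * w * (k * w)))) + PY * (k * w * (k * w)))" for u v w
    by (simp_all only: algebra_simps power2_eq_square mult_1_left mult_1_right)
  have U: "u1 \<in> U" "v1 \<in> U" "w1 \<in> U" "u2 \<in> U" "v2 \<in> U" "w2 \<in> U"
    "u3 \<in> U" "v3 \<in> U" "w3 \<in> U" "u4 \<in> U" "v4 \<in> U" "w4 \<in> U"
    by (simp_all add: U_def)
  note vanish = common_value_vanishes_mod_M[OF U[THEN R]
      arg_cong[OF eq(1), of "\<lambda>t. k^2 * t", unfolded scale]
      arg_cong[OF eq(2), of "\<lambda>t. k^2 * t", unfolded scale]
      arg_cong[OF eq(3), of "\<lambda>t. k^2 * t", unfolded scale]]
  \<comment> \<open>\<open>d\<close> is itself one of the coefficients, and scaling turns it into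
    1.\<close>
  obtain q i j where q: "q \<in> U" "d = coeff2 q i j" using d(1) by (auto simp: A_def)
  have "coeff2 (k * q) i j \<in> M" by (rule vanish) (use q(1) in \<open>auto simp: U_def\<close>)
  then have "1 \<in> M" using q d0 by (simp add: k)
  then show False using one_notin_M by contradiction
qed

section \<open>From quaternion algebras to polynomials\<close>

lemma common_denominator:
  fixes A :: "'a::idom fract set"
  assumes "finite A"
  shows "\<exists>d. d \<noteq> 0 \<and> (\<forall>u\<in>A. \<exists>n. Fract d 1 * u = Fract n 1)"
  using assms
proof (induction A)
  case empty
  then show ?case by (auto intro: exI[of _ 1])
next
  case (insert u A)
  then obtain d where d: "d \<noteq> 0" "\<And>v. v \<in> A \<Longrightarrow> \<exists>n. Fract d 1 * v = Fract n 1" by blast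
  obtain a b where u: "u = Fract a b" "b \<noteq> 0" by (cases u) auto
  have "\<exists>n. Fract (b * d) 1 * v = Fract n 1" if "v \<in> insert u A" for v
  proof (cases "v = u")
    case True
    then show ?thesis using u by (auto intro!: exI[of _ "d * a"] simp: eq_fract)
  next
    case False
    then have "v \<in> A" using that by simp
    then obtain n where n: "Fract d 1 * v = Fract n 1" using d(2) by blast
    have "Fract (b * d) 1 * v = Fract b 1 * (Fract d 1 * v)" by (simp flip: mult.assoc)
    then have "Fract (b * d) 1 * v = Fract b 1 * Fract n 1" by (simp only: n)
    then show ?thesis by auto
  qed
  then show ?case using d u by (intro exI[of _ "b * d"]) auto
qed

lemma Fract_1_injective: "Fract a 1 = Fract b 1 \<longleftrightarrow> a = b"
  by (simp add: eq_fract)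

lemma X1_eq: "X1 = Fract PX 1" and X2_eq: "X2 = Fract PY 1"
  by (simp_all add: X1_def X2_def PX_def PY_def)

text \<open>The equations are homogeneous of degree 2 in all twelve unknowns, so multiplying by the
  square of a common denominator makes them polynomial.\<close>

lemma no_common_value:
  fixes u1 v1 w1 u2 v2 w2 u3 v3 w3 u4 v4 w4 :: ratfun2
  assumes eq: "X1 * u1^2 + X2 * v1^2 - X1 * X2 * w1^2
       = X1 * u2^2 + (X2 + 1) * v2^2 - X1 * (X2 + 1) * w2^2"
     "X1 * u1^2 + X2 * v1^2 - X1 * X2 * w1^2
       = X2 * u3^2 + (X1 + 1) * v3^2 - X2 * (X1 + 1) * w3^2"
     "X1 * u1^2 + X2 * v1^2 - X1 * X2 * w1^2
       = X2 * u4^2 + (X1 * X2 + 1) * v4^2 - X2 * (X1 * X2 + 1) * w4^2"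
  shows "u1 = 0 \<and> v1 = 0 \<and> w1 = 0"
proof -
  obtain d where d: "d \<noteq> 0" "\<forall>u\<in>{u1, v1, w1, u2, v2, w2, u3, v3, w3, u4, v4, w4}.
      \<exists>n. Fract d 1 * u = Fract n 1"
    using common_denominator[of "{u1, v1, w1, u2, v2, w2, u3, v3, w3, u4, v4, w4}"] by auto
  define D where "D = Fract d 1"
  have D: "D \<noteq> 0" using d(1) by (simp add: D_def Zero_fract_def eq_fract)
  from d(2) obtain p1 q1 r1 p2 q2 r2 p3 q3 r3 p4 q4 r4 where n:
    "D * u1 = Fract p1 1" "D * v1 = Fract q1 1" "D * w1 = Fract r1 1"
    "D * u2 = Fract p2 1" "D * v2 = Fract q2 1" "D * w2 = Fract r2 1"
    "D * u3 = Fract p3 1" "D * v3 = Fract q3 1" "D * w3 = Fract r3 1"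
    "D * u4 = Fract p4 1" "D * v4 = Fract q4 1" "D * w4 = Fract r4 1"
    unfolding D_def by auto
  have conv: "D^2 * (a * u^2 + b * v^2 - e * w^2) = a * (D * u)^2 + b * (D * v)^2 - e * (D * w)^2"
    for a b e u v w :: ratfun2
    by (simp add: algebra_simps power_mult_distrib)
  have "PX * p1^2 + PY * q1^2 - PX * PY * r1^2
      = PX * p2^2 + (PY + 1) * q2^2 - PX * (PY + 1) * r2^2"
    using arg_cong[OF eq(1), of "\<lambda>t. D^2 * t"] unfolding conv n X1_eq X2_eq
    by (simp add: power2_eq_square One_fract_def Fract_1_injective)
  moreover have "PX * p1^2 + PY * q1^2 - PX * PY * r1^2
      = PY * p3^2 + (PX + 1) * q3^2 - PY * (PX + 1) * r3^2"
    using arg_cong[OF eq(2), of "\<lambda>t. D^2 * t"] unfolding conv n X1_eq X2_eq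
    by (simp add: power2_eq_square One_fract_def Fract_1_injective)
  moreover have "PX * p1^2 + PY * q1^2 - PX * PY * r1^2
      = PY * p4^2 + (PX * PY + 1) * q4^2 - PY * (PX * PY + 1) * r4^2"
    using arg_cong[OF eq(3), of "\<lambda>t. D^2 * t"] unfolding conv n X1_eq X2_eq
    by (simp add: power2_eq_square One_fract_def Fract_1_injective)
  ultimately have "p1 = 0 \<and> q1 = 0 \<and> r1 = 0"
    using no_common_value_polynomial by blast
  then show ?thesis using n(1-3) D by (simp add: Zero_fract_def[symmetric])
qed

section \<open>Quadratic extensions and pure quaternions\<close>

lemma quadratic_extension_proper:
  assumes "quadratic_extension \<iota>"
  obtains z where "z \<notin> range \<iota>"
proof (rule ccontr)
  assume "\<not> thesis"
  then have surj: "\<And>z. \<exists>a. z = \<iota> a" using that by blast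
  have hom: "\<And>x y. \<iota> (x + y) = \<iota> x + \<iota> y" "\<And>x y. \<iota> (x * y) = \<iota> x * \<iota> y"
    using assms by (auto simp: quadratic_extension_def)
  from assms have "\<exists>e1 e2. \<forall>z. \<exists>!c. z = \<iota> (fst c) * e1 + \<iota> (snd c) * e2"
    unfolding quadratic_extension_def by (elim conjE)
  then obtain e1 e2 where e: "\<And>z. \<exists>!c. z = \<iota> (fst c) * e1 + \<iota> (snd c) * e2"
    by auto
  obtain a b where ab: "e1 = \<iota> a" "e2 = \<iota> b" using surj by blast
  have "c = c'" if "\<iota> (fst c) * e1 + \<iota> (snd c) * e2 = \<iota> (fst c') * e1 + \<iota> (snd c') * e2" for c c'
    using e that by metis
  then have inj: "c = c'" if "\<iota> (fst c * a + snd c * b) = \<iota> (fst c' * a + snd c' * b)" for c c'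
    using that by (simp add: ab hom)
  \<comment> \<open>Both pairs are coordinates of 0, whence \<open>a = b = 0\<close>; then
    \<open>(1, 0)\<close> and \<open>(0, 0)\<close> collide as well.\<close>
  have "(b, - a) = (0, 0)" by (rule inj) (simp add: mult.commute)
  then have "b = 0" "a = 0" by simp_all
  then have "(1 :: 'a, 0 :: 'a) = (0, 0)" by (intro inj) simp
  then show False by simp
qed

text \<open>For \<open>\<phi> z = (t, u, v, w)\<close> the nonscalar parts of the square are
  \<open>2 * t * u\<close>, \<open>2 * t * v\<close>, \<open>2 * t * w\<close>. They vanish, while
  \<open>z\<close> outside the base field has a nonzero vector part, so
  \<open>t = 0\<close>.\<close>

lemma quat_embedding_pure_square:
  fixes \<iota> :: "'f::field \<Rightarrow> 'l::field"
  assumes two: "(2::'f) \<noteq> 0"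
    and \<phi>: "quat_embedding a b \<iota> \<phi>" and z: "z \<notin> range \<iota>" and zz: "z * z = \<iota> c"
  obtains u v w where "c = a * u^2 + b * v^2 - a * b * w^2" "(u, v, w) \<noteq> (0, 0, 0)"
proof -
  obtain t u v w where q: "\<phi> z = (t, u, v, w)" by (metis prod_cases4)
  have inj: "inj \<phi>" and mult: "\<phi> (z * z) = qmul a b (\<phi> z) (\<phi> z)"
    and \<iota>: "\<phi> (\<iota> c) = (c, 0, 0, 0)" "\<phi> (\<iota> t) = (t, 0, 0, 0)"
    using \<phi> by (auto simp: quat_embedding_def)
  have nz: "(u, v, w) \<noteq> (0, 0, 0)"
  proof
    assume "(u, v, w) = (0, 0, 0)"
    then have "\<phi> z = \<phi> (\<iota> t)" using q \<iota> by simp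
    then show False using inj z by (auto dest: injD)
  qed
  have eqs: "c = t * t + a * u * u + b * v * v - a * b * w * w"
    "0 = t * u + u * t" "0 = t * v + v * t" "0 = t * w + w * t"
    using mult unfolding zz \<iota> q by (auto simp: qmul_def)
  then have "2 * (t * u) = 0" "2 * (t * v) = 0" "2 * (t * w) = 0"
    by (simp_all add: mult_2 mult.commute)
  then have "t = 0" using nz two by auto
  then show ?thesis using that eqs(1) nz by (simp add: power2_eq_square mult.assoc)
qed

text \<open>Completing the square inside one algebra: subtracting the scalar part leaves a pure
  quaternion, whose square is a scalar. Injectivity of \<open>\<phi>\<close> brings this back to the
  extension field.\<close>

lemma quadratic_extension_square_generator:
  fixes \<iota> :: "'f::field \<Rightarrow> 'l::field"
  assumes "quadratic_extension \<iota>" and \<phi>: "quat_embedding a b \<iota> \<phi>"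
  obtains z c where "z \<notin> range \<iota>" "z * z = \<iota> c"
proof -
  obtain y where y: "y \<notin> range \<iota>" using quadratic_extension_proper[OF assms(1)] .
  have hom: "\<And>x y. \<iota> (x + y) = \<iota> x + \<iota> y"
    using assms(1) by (auto simp: quadratic_extension_def)
  have emb: "inj \<phi>" "\<And>x y. \<phi> (x + y) = qadd (\<phi> x) (\<phi> y)"
    "\<And>x y. \<phi> (x * y) = qmul a b (\<phi> x) (\<phi> y)" "\<And>c. \<phi> (\<iota> c) = (c, 0, 0, 0)"
    using \<phi> by (auto simp: quat_embedding_def)
  obtain t u v w where q: "\<phi> y = (t, u, v, w)" by (metis prod_cases4)
  define z where "z = y + \<iota> (- t)"
  have pure: "\<phi> z = (0, u, v, w)" by (simp add: z_def emb q qadd_def)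
  have "\<phi> (z * z) = \<phi> (\<iota> (a * u * u + b * v * v - a * b * w * w))"
    by (simp add: emb pure qmul_def)
  then have "z * z = \<iota> (a * u * u + b * v * v - a * b * w * w)" by (rule injD[OF emb(1)])
  moreover have "z \<notin> range \<iota>"
  proof
    assume "z \<in> range \<iota>"
    then obtain s where "z = \<iota> s" by blast
    moreover have "y = z + \<iota> t"
    proof -
      have "\<iota> 0 = \<iota> 0 + \<iota> 0" using hom[of 0 0] by (simp only: add_0_left)
      then have "\<iota> 0 = 0" by (simp only: add_cancel_right_right)
      then have "\<iota> (- t) + \<iota> t = 0" using hom[of "- t" t] by simp
      then show ?thesis by (simp add: z_def add.assoc)
    qed
    ultimately have "y = \<iota> (s + t)" by (simp add: hom)
    then show False using y by blast
  qed
  ultimately show ?thesis using that by blast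
qed

theorem theoremA:
  fixes \<iota> :: "ratfun2 \<Rightarrow> 'l::field"
    and \<phi>1 \<phi>2 \<phi>3 \<phi>4 :: "'l \<Rightarrow> ratfun2 quat"
  shows "\<not> (quadratic_extension \<iota> \<and>
             quat_embedding X1 X2 \<iota> \<phi>1 \<and>
             quat_embedding X1 (X2 + 1) \<iota> \<phi>2 \<and>
             quat_embedding X2 (X1 + 1) \<iota> \<phi>3 \<and>
             quat_embedding X2 (X1 * X2 + 1) \<iota> \<phi>4)"
proof (intro notI, elim conjE)
  assume L: "quadratic_extension \<iota>"
    and \<phi>: "quat_embedding X1 X2 \<iota> \<phi>1" "quat_embedding X1 (X2 + 1) \<iota> \<phi>2"
      "quat_embedding X2 (X1 + 1) \<iota> \<phi>3" "quat_embedding X2 (X1 * X2 + 1) \<iota> \<phi>4"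
  have "Fract (2 :: complex poly poly) 1 \<noteq> 0" by (simp add: Zero_fract_def eq_fract)
  moreover have "(2 :: ratfun2) = Fract 1 1 + Fract 1 1"
    by (simp flip: One_fract_def)
  then have "(2 :: ratfun2) = Fract 2 1" by simp
  ultimately have two: "(2 :: ratfun2) \<noteq> 0" by metis
  \<comment> \<open>\<open>z\<close> and \<open>c\<close> are fixed in the extension, so the same
    \<open>c\<close> serves in all four algebras.\<close>
  obtain z c where z: "z \<notin> range \<iota>" "z * z = \<iota> c"
    using quadratic_extension_square_generator[OF L \<phi>(1)] .
  obtain u1 v1 w1 where 1: "c = X1 * u1^2 + X2 * v1^2 - X1 * X2 * w1^2"
    "(u1, v1, w1) \<noteq> (0, 0, 0)"
    using quat_embedding_pure_square[OF two \<phi>(1) z] .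
  obtain u2 v2 w2 where 2: "c = X1 * u2^2 + (X2 + 1) * v2^2 - X1 * (X2 + 1) * w2^2"
    using quat_embedding_pure_square[OF two \<phi>(2) z] .
  obtain u3 v3 w3 where 3: "c = X2 * u3^2 + (X1 + 1) * v3^2 - X2 * (X1 + 1) * w3^2"
    using quat_embedding_pure_square[OF two \<phi>(3) z] .
  obtain u4 v4 w4 where 4: "c = X2 * u4^2 + (X1 * X2 + 1) * v4^2 - X2 * (X1 * X2 + 1) * w4^2"
    using quat_embedding_pure_square[OF two \<phi>(4) z] .
  show False
    using no_common_value[OF 1(1)[symmetric, THEN trans, OF 2] 1(1)[symmetric, THEN trans, OF 3]
        1(1)[symmetric, THEN trans, OF 4]] 1(2) by simp
qed

end
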